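(* Let $n\ge1$ and let $\tau^{(n)}$ be as defined in the context. For every $(v_1,\dots,v_n)\in\{0,1,2\}^n$, the $n$-th coordinate $t_n$ of $\tau^{(n)}(v_1,\dots,v_n)$ is $$t_n=2^{n-1}\Bigl(v_n+\sum_{i=1}^{n-1}2^{n-1-i}v_i\Bigr)\bmod 3,$$ so that $t_n\equiv 2^{n-1}\widetilde{\widetilde v}_n\pmod 3$, where $\widetilde{\widetilde v}_n=\bigl(v_n+\sum_{i=1}^{n-1}2^{n-1-i}v_i\bigr)\bmod 3$.
   Context: Define maps $\tau^{(n)}:\{0,1,2\}^n\to\{0,1,2\}^n$ recursively: $\tau^{(1)}$ is the identity, and for $n\ge2$, $\tau^{(n)}(v_1,\dots,v_n)=\bigl(v_1,\ \tau^{(n-1)}(2(v_1+v_2)\bmod 3,\dots,2(v_1+v_n)\bmod 3)\bigr)$. *)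

theory Defs
  imports Main "HOL-Number_Theory.Cong"
begin

definition ternary_words :: "nat \<Rightarrow> nat list set" where
  "ternary_words n = {v. length v = n \<and> set v \<subseteq> {0, 1, 2}}"

text \<open>The maps \<open>\<tau>\<^sup>(\<^sup>n\<^sup>)\<close> are collected in one function on lists, \<open>n\<close> being the length of the
  argument. The value on the empty list is a dummy: the maps are only considered for \<open>n \<ge> 1\<close>.\<close>

function tau :: "nat list \<Rightarrow> nat list" where
  "tau [] = []"
| "tau [v] = [v]"
| "tau (v # w # ws) = v # tau (map (\<lambda>x. (2 * (v + x)) mod 3) (w # ws))"
  by pat_completeness auto
termination by (relation "measure length") auto

lemma tau_ternary_words: "v \<in> ternary_words n \<Longrightarrow> tau v \<in> ternary_words n"
proof (induction v arbitrary: n rule: tau.induct)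
  case (3 v w ws)
  let ?u = "map (\<lambda>x. (2 * (v + x)) mod 3) (w # ws)"
  have mod3: "x mod 3 \<in> {0, 1, 2}" for x :: nat
  proof -
    have "x mod 3 < 3" by simp
    then have "x mod 3 = 0 \<or> x mod 3 = 1 \<or> x mod 3 = 2" by linarith
    then show ?thesis by blast
  qed
  have "set ?u \<subseteq> {0, 1, 2}"
    unfolding set_map by (rule image_subsetI) (rule mod3)
  then have "?u \<in> ternary_words (length (w # ws))"
    unfolding ternary_words_def by (simp only: mem_Collect_eq length_map simp_thms)
  then have "tau ?u \<in> ternary_words (length (w # ws))"
    by (rule "3.IH")
  with "3.prems" show ?case
    unfolding ternary_words_def tau.simps(3)
    by (simp only: mem_Collect_eq list.size(4) list.set(2) insert_subset simp_thms)
qed (simp_all add: ternary_words_def)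

text \<open>Coordinates \<open>v\<^sub>1, \<dots>, v\<^sub>n\<close> are 1-based, so \<open>v\<^sub>i\<close> is \<open>v ! (i - 1)\<close>.\<close>

definition v_tilde2 :: "nat \<Rightarrow> nat list \<Rightarrow> nat" where
  "v_tilde2 n v = (v ! (n - 1) + (\<Sum>i = 1..n - 1. 2 ^ (n - 1 - i) * v ! (i - 1))) mod 3"

end

theory Submission
  imports Defs
begin

text \<open>Induction on the length. Modulo 3, the tail \<open>w\<close> of a word
  \<open>a # w\<close> is replaced by the entries \<open>2 * (a + x)\<close>, and the induction
  hypothesis applies to this new word. A factor 2 comes out, raising the power in front by one; the
  copies of \<open>a\<close> add up to \<open>a\<close> times 1 plus a geometric sum, which by
  \<open>Suc_sum_power2_rev\<close> is a single power of 2: exactly the weight of the first letter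
  in the longer word.\<close>

lemma Suc_sum_power2_rev: "Suc (\<Sum>i<m. 2 ^ (m - Suc i)) = 2 ^ m"
proof -
  have "Suc (\<Sum>i<m. 2 ^ i) = 2 ^ m"
    by (induction m) auto
  then show ?thesis
    by (simp add: sum.nat_diff_reindex[of "\<lambda>i. 2 ^ i"])
qed

lemma length_tau [simp]: "length (tau v) = length v"
  by (induction v rule: tau.induct) auto

text \<open>The formula with 0-based indices, kept as a congruence so that the reductions mod 3
  inside \<open>tau\<close> can be discarded at each inductive step.\<close>

lemma tau_last_cong:
  assumes "length v = Suc m"
  shows "[tau v ! m = 2 ^ m * (v ! m + (\<Sum>i<m. 2 ^ (m - Suc i) * v ! i))] (mod 3)"
  using assms
proof (induction m arbitrary: v)
  case 0
  then obtain a where "v = [a]"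
    by (auto simp: length_Suc_conv)
  then show ?case by simp
next
  case (Suc m)
  then obtain a w where v: "v = a # w" and w: "length w = Suc m"
    by (auto simp: length_Suc_conv)
  define u where "u = map (\<lambda>x. (2 * (a + x)) mod 3) w"
  have u: "[u ! i = 2 * (a + w ! i)] (mod 3)" if "i \<le> m" for i
    using that w by (simp add: u_def cong_def)
  have "tau v = a # tau u"
    \<comment> \<open>\<open>w\<close> is nonempty, so the recursive equation of \<open>tau\<close>
      applies.\<close>
    using w by (cases w) (simp_all add: v u_def)
  then have "tau v ! Suc m = tau u ! m"
    by simp
  moreover have "[tau u ! m = 2 ^ m * (u ! m + (\<Sum>i<m. 2 ^ (m - Suc i) * u ! i))] (mod 3)"
    by (rule Suc.IH) (simp add: u_def w)
  moreover have "[2 ^ m * (u ! m + (\<Sum>i<m. 2 ^ (m - Suc i) * u ! i)) =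
      2 ^ m * (2 * (a + w ! m) + (\<Sum>i<m. 2 ^ (m - Suc i) * (2 * (a + w ! i))))] (mod 3)"
    by (intro cong_mult cong_add cong_sum cong_refl u) auto
  moreover have "2 ^ m * (2 * (a + w ! m) + (\<Sum>i<m. 2 ^ (m - Suc i) * (2 * (a + w ! i)))) =
      2 ^ Suc m * (v ! Suc m + (\<Sum>i<Suc m. 2 ^ (Suc m - Suc i) * v ! i))"
  proof -
    \<comment> \<open>The \<open>Suc\<close> collects the copy of \<open>a\<close> from the last
      letter, the sum those from the earlier ones.\<close>
    have "2 ^ m * (2 * (a + w ! m) + (\<Sum>i<m. 2 ^ (m - Suc i) * (2 * (a + w ! i)))) =
        2 ^ Suc m * (w ! m + (a * Suc (\<Sum>i<m. 2 ^ (m - Suc i)) + (\<Sum>i<m. 2 ^ (m - Suc i) * w ! i)))"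
      by (simp add: algebra_simps sum.distrib sum_distrib_left)
    moreover have "(\<Sum>i<Suc m. 2 ^ (Suc m - Suc i) * v ! i) =
        a * 2 ^ m + (\<Sum>i<m. 2 ^ (m - Suc i) * w ! i)"
      unfolding v sum.lessThan_Suc_shift by simp
    ultimately show ?thesis
      unfolding Suc_sum_power2_rev by (simp only: v nth_Cons_Suc)
  qed
  ultimately show ?case
    by (simp only: cong_def)
qed

theorem theorem5:
  fixes n :: nat and v :: "nat list"
  assumes "n \<ge> 1" and "v \<in> ternary_words n"
  shows "tau v ! (n - 1) =
           (2 ^ (n - 1) * (v ! (n - 1) + (\<Sum>i = 1..n - 1. 2 ^ (n - 1 - i) * v ! (i - 1)))) mod 3
         \<and> [tau v ! (n - 1) = 2 ^ (n - 1) * v_tilde2 n v] (mod 3)"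
proof -
  obtain m where n: "n = Suc m"
    using assms(1) by (cases n) auto
  have len: "length v = Suc m"
    using assms(2) by (simp add: ternary_words_def n)
  have sum: "(\<Sum>i = 1..m. 2 ^ (m - i) * v ! (i - 1)) = (\<Sum>i<m. 2 ^ (m - Suc i) * v ! i)"
    by (simp add: sum.atLeast1_atMost_eq)
  \<comment> \<open>Letters of \<open>tau v\<close> are their own residues, which turns the
    congruence into the claimed equality.\<close>
  have "set (tau v) \<subseteq> {0, 1, 2}"
    using tau_ternary_words[OF assms(2)] by (simp add: ternary_words_def)
  moreover have "tau v ! m \<in> set (tau v)"
    by (simp add: len)
  ultimately have "tau v ! m \<in> {0, 1, 2}"
    by (rule subsetD)
  then have "tau v ! m mod 3 = tau v ! m"
    by auto
  with tau_last_cong[OF len] show ?thesis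
    by (simp add: n sum[simplified] v_tilde2_def cong_def mod_mult_right_eq)
qed

end
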